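(* Let $M$ be a matroid of rank $2$ (on a finite ground set), and let $M^*$ be its dual matroid. Then the $h$-vector $h(M^* )$ is a pure $O$-sequence.
   Context: A matroid $M=(E(M),\mathcal{I}(M))$ has a finite ground set $E(M)$ and family of independent sets $\mathcal{I}(M)\subseteq 2^{E(M)}$; its rank is the cardinality of a maximal independent set (a basis). The dual matroid $M^*$ is the matroid on $E(M)$ whose bases are the sets $E(M)\setminus B$, where $B$ ranges over the bases of $M$. If a matroid $N$ has rank $d$, its $f$-vector is $(f_{-1}(N),f_0(N),\ldots,f_{d-1}(N))$ with $f_{i-1}(N)=|\{A\in\mathcal{I}(N): |A|=i\}|$. Its $h$-vector $h(N)=(h_0(N),\ldots,h_d(N))$ is defined by the polynomial identity in $\lambda$ $$\sum_{j=0}^d h_j(N)\lambda^j=\sum_{i=0}^d f_{i-1}(N)\lambda^i(1-\lambda)^{d-i}.$$ An order ideal $\mathcal{O}$ is a nonempty family of monomials (in finitely many variables) of degree at most some $r$, such that if $\mu\in\mathcal{O}$ and $\nu\mid\mu$ then $\nu\in\mathcal{O}$. Put $F_i(\mathcal{O})=$ the number of monomials of degree $i$ in $\mathcal{O}$ and $F(\mathcal{O})=(F_0(\mathcal{O}),\ldots,F_r(\mathcal{O}))$; trailing entries are allowed to be zero. $\mathcal{O}$ is pure if all of its maximal monomials under divisibility have the same degree. A vector $\mathbf{h}=(h_0,\ldots,h_d)$ is a pure $O$-sequence if there is a pure order ideal $\mathcal{O}$ of monomials of degree at most $d$ with $\mathbf{h}=F(\mathcal{O})=(F_0(\mathcal{O}),\ldots,F_d(\mathcal{O}))$.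 *)

theory Defs
  imports "HOL-Library.Multiset" "HOL-Computational_Algebra.Polynomial"
begin

section \<open>Matroids\<close>

locale matroid =
  fixes E :: "'a set" and \<I> :: "'a set set"
  assumes finite_ground: "finite E"
    and indep_subset_ground: "A \<in> \<I> \<Longrightarrow> A \<subseteq> E"
    and empty_indep: "{} \<in> \<I>"
    and indep_subset: "A \<in> \<I> \<Longrightarrow> A' \<subseteq> A \<Longrightarrow> A' \<in> \<I>"
    and augment: "A \<in> \<I> \<Longrightarrow> A' \<in> \<I> \<Longrightarrow> card A < card A' \<Longrightarrow>
      \<exists>x \<in> A' - A. insert x A \<in> \<I>"

definition basis :: "'a set set \<Rightarrow> 'a set \<Rightarrow> bool" where
  "basis \<I> B \<longleftrightarrow> B \<in> \<I> \<and> (\<forall>A \<in> \<I>. B \<subseteq> A \<longrightarrow> A = B)"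

text \<open>Well-defined for matroids, see \<open>card_basis\<close> below.\<close>

definition matroid_rank :: "'a set set \<Rightarrow> nat" where
  "matroid_rank \<I> = (THE r. \<exists>B. basis \<I> B \<and> card B = r)"

text \<open>The independent sets of the dual matroid: all subsets of complements of bases. That they
  form a matroid on the same ground set, whose bases are exactly the complements of bases, is
  shown in \<open>matroid_dual\<close> and \<open>basis_dual_iff\<close> below.\<close>

definition dual_indep :: "'a set \<Rightarrow> 'a set set \<Rightarrow> 'a set set" where
  "dual_indep E \<I> = {A. \<exists>B. basis \<I> B \<and> A \<subseteq> E - B}"

context matroid
begin

lemma finite_indep: "A \<in> \<I> \<Longrightarrow> finite A"
  using finite_ground indep_subset_ground finite_subset by blast

lemma card_basis_eq:
  assumes "basis \<I> B" "basis \<I> C"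
  shows "card B = card C"
proof -
  have "card C \<le> card B" if B: "basis \<I> B" and C: "basis \<I> C" for B C
  proof (rule ccontr)
    assume "\<not> card C \<le> card B"
    then obtain x where "x \<in> C - B" "insert x B \<in> \<I>"
      using B C augment[of B C] unfolding basis_def by auto
    then show False using B unfolding basis_def by blast
  qed
  with assms show ?thesis by (simp add: order.antisym)
qed

lemma card_basis: "basis \<I> B \<Longrightarrow> card B = matroid_rank \<I>"
  unfolding matroid_rank_def by (rule sym, rule the_equality) (auto intro: card_basis_eq)

lemma indep_card_le_basis:
  assumes "A \<in> \<I>" "basis \<I> B"
  shows "card A \<le> card B"
proof (rule ccontr)
  assume "\<not> card A \<le> card B"
  then obtain x where "x \<in> A - B" "insert x B \<in> \<I>"
    using assms augment[of B A] unfolding basis_def by auto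
  then show False using assms unfolding basis_def by blast
qed

lemma basis_if_card:
  assumes "A \<in> \<I>" "basis \<I> B" "card A = card B"
  shows "basis \<I> A"
  unfolding basis_def
proof (intro conjI ballI impI)
  fix D assume "D \<in> \<I>" "A \<subseteq> D"
  then show "D = A"
    using assms(2,3) indep_card_le_basis[of D B] finite_indep[of D] card_seteq[of D A] by simp
qed (rule assms(1))

lemma extend_to_basis:
  assumes "J \<in> \<I>" "J \<subseteq> S" "basis \<I> B" "B \<subseteq> S"
  shows "\<exists>C. basis \<I> C \<and> J \<subseteq> C \<and> C \<subseteq> S"
proof -
  let ?P = "\<lambda>C. C \<in> \<I> \<and> J \<subseteq> C \<and> C \<subseteq> S"
  have "\<exists>C. ?P C \<and> (\<forall>D. ?P D \<longrightarrow> card D \<le> card C)"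
    using assms(1,2,3) by (intro ex_has_greatest_nat[where b = "Suc (card B)" and k = J])
      (auto intro: indep_card_le_basis le_imp_less_Suc)
  then obtain C where C: "?P C" and max: "\<And>D. ?P D \<Longrightarrow> card D \<le> card C" by blast
  have "\<not> card C < card B"
  proof
    assume "card C < card B"
    then obtain x where x: "x \<in> B - C" "insert x C \<in> \<I>"
      using C assms(3) augment[of C B] unfolding basis_def by blast
    then have "card (insert x C) \<le> card C" using C assms(4) by (intro max) auto
    with x C finite_indep[of C] show False by auto
  qed
  with C assms(3) indep_card_le_basis[of C B] have "card C = card B" by simp
  with C assms(3) basis_if_card[of C B] show ?thesis by blast
qed

lemma basis_exists: "\<exists>B. basis \<I> B"
proof -
  have "finite \<I>"
    using indep_subset_ground by (intro finite_subset[of \<I> "Pow E"]) (auto simp: finite_ground)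
  then obtain B where "B \<in> \<I>" "\<forall>A \<in> \<I>. B \<subseteq> A \<longrightarrow> B = A"
    using finite_has_maximal[of \<I>] empty_indep by blast
  then show ?thesis unfolding basis_def by blast
qed

lemma basis_subset_ground: "basis \<I> B \<Longrightarrow> B \<subseteq> E"
  unfolding basis_def using indep_subset_ground by blast

lemma basis_dual_iff: "basis (dual_indep E \<I>) A \<longleftrightarrow> (\<exists>B. basis \<I> B \<and> A = E - B)"
proof
  assume "basis (dual_indep E \<I>) A"
  then have A: "A \<in> dual_indep E \<I>" and max: "\<And>D. D \<in> dual_indep E \<I> \<Longrightarrow> A \<subseteq> D \<Longrightarrow> D = A"
    unfolding basis_def[of "dual_indep E \<I>"] by blast+
  from A obtain B where B: "basis \<I> B" "A \<subseteq> E - B" unfolding dual_indep_def by blast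
  then have "E - B \<in> dual_indep E \<I>" unfolding dual_indep_def by blast
  then have "E - B = A" using B(2) by (rule max)
  with B(1) show "\<exists>B. basis \<I> B \<and> A = E - B" by blast
next
  assume "\<exists>B. basis \<I> B \<and> A = E - B"
  then obtain B where B: "basis \<I> B" "A = E - B" by blast
  have "D = E - B" if D: "basis \<I> C" "D \<subseteq> E - C" "E - B \<subseteq> D" for C D
  proof -
    have "C \<subseteq> B" using D basis_subset_ground by blast
    then have "C = B" using D(1) B(1) unfolding basis_def by blast
    then show ?thesis using D(2,3) by blast
  qed
  then have "D = A" if "D \<in> dual_indep E \<I>" "A \<subseteq> D" for D
    using that B(2) unfolding dual_indep_def by auto
  moreover have "A \<in> dual_indep E \<I>" using B unfolding dual_indep_def by blast
  ultimately show "basis (dual_indep E \<I>) A" by (simp add: basis_def)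
qed

lemma matroid_dual: "matroid E (dual_indep E \<I>)"
proof
  show "finite E" by (rule finite_ground)
  show "A \<subseteq> E" if "A \<in> dual_indep E \<I>" for A using that unfolding dual_indep_def by blast
  show "{} \<in> dual_indep E \<I>" using basis_exists unfolding dual_indep_def by blast
  show "A' \<in> dual_indep E \<I>" if "A \<in> dual_indep E \<I>" "A' \<subseteq> A" for A A'
    using that unfolding dual_indep_def by blast
  show "\<exists>x \<in> A' - A. insert x A \<in> dual_indep E \<I>"
    if A: "A \<in> dual_indep E \<I>" and A': "A' \<in> dual_indep E \<I>" and less: "card A < card A'" for A A'
  proof (rule ccontr)
    assume neg: "\<not> ?thesis"
    obtain B B' where B: "basis \<I> B" "A \<subseteq> E - B" and B': "basis \<I> B'" "A' \<subseteq> E - B'"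
      using A A' unfolding dual_indep_def by blast
    have sub: "A \<subseteq> E" "A' \<subseteq> E" "B \<subseteq> E" "B' \<subseteq> E"
      using B(2) B'(2) basis_subset_ground[OF B(1)] basis_subset_ground[OF B'(1)] by auto
    have "B' \<in> \<I>" using B'(1) by (simp add: basis_def)
    then have "B' - A \<in> \<I>" by (rule indep_subset) blast
    moreover have "B' - A \<subseteq> E - A" "B \<subseteq> E - A" using B(2) sub by auto
    ultimately obtain C where C: "basis \<I> C" "B' - A \<subseteq> C" "C \<subseteq> E - A"
      using extend_to_basis[OF _ _ B(1)] by metis
    have "A' - A \<subseteq> C"
    proof
      fix x assume x: "x \<in> A' - A"
      show "x \<in> C"
      proof (rule ccontr)
        assume "x \<notin> C"
        then have "insert x A \<subseteq> E - C" using x C(3) sub by auto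
        then have "insert x A \<in> dual_indep E \<I>" using C(1) unfolding dual_indep_def by blast
        then show False using x neg by blast
      qed
    qed
    have fin: "finite A" "finite A'" "finite B'" "finite C"
      using sub C(3) by (auto intro: finite_subset[OF _ finite_ground])
    have "card (A' - A) + card (B' - A) = card ((A' - A) \<union> (B' - A))"
      using fin B'(2) by (subst card_Un_disjoint) auto
    also have "\<dots> \<le> card C" using \<open>A' - A \<subseteq> C\<close> C(2) fin by (intro card_mono) auto
    also have "\<dots> = card B'" using card_basis_eq[OF C(1) B'(1)] .
    also have "\<dots> = card (B' - A) + card (B' \<inter> A)"
      using card_Int_Diff[OF fin(3), of A] by simp
    finally have "card (A' - A) \<le> card (B' \<inter> A)" by simp
    also have "\<dots> \<le> card (A - A')" using fin B'(2) by (intro card_mono) auto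
    finally have "card (A' - A) \<le> card (A - A')" .
    moreover have "card A = card (A - A') + card (A \<inter> A')" "card A' = card (A' - A) + card (A \<inter> A')"
      using card_Int_Diff[OF fin(1), of A'] card_Int_Diff[OF fin(2), of A] by (simp_all add: Int_commute)
    ultimately show False using less by simp
  qed
qed

end

section \<open>The \<open>h\<close>-vector\<close>

text \<open>\<open>num_indep \<I> i\<close> is \<open>f\<^sub>i\<^sub>-\<^sub>1\<close>: the index counts elements, not dimension.\<close>

definition num_indep :: "'a set set \<Rightarrow> nat \<Rightarrow> nat" where
  "num_indep \<I> i = card {A \<in> \<I>. card A = i}"

definition h_poly :: "'a set set \<Rightarrow> int poly" where
  "h_poly \<I> = (\<Sum>i\<le>matroid_rank \<I>.
     of_nat (num_indep \<I> i) * [:0, 1:] ^ i * [:1, -1:] ^ (matroid_rank \<I> - i))"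

text \<open>The entries are taken in the integers, as their nonnegativity is not part of the
  definition. Since \<open>h_poly\<close> has degree at most the rank, no coefficient is lost.\<close>

definition h_vector :: "'a set set \<Rightarrow> int list" where
  "h_vector \<I> = map (coeff (h_poly \<I>)) [0..<Suc (matroid_rank \<I>)]"

lemma degree_h_poly: "degree (h_poly \<I>) \<le> matroid_rank \<I>"
  unfolding h_poly_def
proof (rule degree_sum_le)
  fix i assume i: "i \<in> {..matroid_rank \<I>}"
  have "degree ([:0, 1::int:] ^ i) \<le> i"
    using degree_power_le[of "[:0, 1::int:]" i] by simp
  moreover have "degree ([:1, -1::int:] ^ (matroid_rank \<I> - i)) \<le> matroid_rank \<I> - i"
    using degree_power_le[of "[:1, -1::int:]" "matroid_rank \<I> - i"] by simp
  moreover have "degree (of_nat (num_indep \<I> i) :: int poly) = 0" by simp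
  ultimately show "degree (of_nat (num_indep \<I> i) * [:0, 1::int:] ^ i
      * [:1, -1:] ^ (matroid_rank \<I> - i)) \<le> matroid_rank \<I>"
    using i by (intro order.trans[OF degree_mult_le]
      order.trans[OF add_mono[OF degree_mult_le order.refl]]) auto
qed simp

lemma h_vector_identity:
  "(\<Sum>j\<le>matroid_rank \<I>. h_vector \<I> ! j * x ^ j) =
   (\<Sum>i\<le>matroid_rank \<I>. int (num_indep \<I> i) * x ^ i * (1 - x) ^ (matroid_rank \<I> - i))"
proof -
  have "(\<Sum>j\<le>matroid_rank \<I>. h_vector \<I> ! j * x ^ j) =
      (\<Sum>j\<le>matroid_rank \<I>. coeff (h_poly \<I>) j * x ^ j)"
    by (intro sum.cong) (auto simp: h_vector_def simp del: upt_Suc)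
  also have "\<dots> = poly (h_poly \<I>) x"
    unfolding poly_altdef using degree_h_poly[of \<I>]
    by (intro sum.mono_neutral_right) (auto simp: coeff_eq_0)
  finally show ?thesis by (simp add: h_poly_def poly_sum)
qed

section \<open>Pure \<open>O\<close>-sequences\<close>

text \<open>A monomial is the multiset of its variables: degree is \<open>size\<close> and divisibility
  is \<open>\<subseteq>#\<close>.\<close>

definition order_ideal :: "nat \<Rightarrow> 'v multiset set \<Rightarrow> bool" where
  "order_ideal r \<O> \<longleftrightarrow>
     \<O> \<noteq> {} \<and>
     (\<exists>V. finite V \<and> (\<forall>\<mu> \<in> \<O>. set_mset \<mu> \<subseteq> V)) \<and>
     (\<forall>\<mu> \<in> \<O>. size \<mu> \<le> r) \<and>
     (\<forall>\<mu> \<in> \<O>. \<forall>\<nu>. \<nu> \<subseteq># \<mu> \<longrightarrow> \<nu> \<in> \<O>)"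

definition maximal_monomial :: "'v multiset set \<Rightarrow> 'v multiset \<Rightarrow> bool" where
  "maximal_monomial \<O> \<mu> \<longleftrightarrow> \<mu> \<in> \<O> \<and> (\<forall>\<nu> \<in> \<O>. \<mu> \<subseteq># \<nu> \<longrightarrow> \<nu> = \<mu>)"

definition pure_ideal :: "'v multiset set \<Rightarrow> bool" where
  "pure_ideal \<O> \<longleftrightarrow> (\<forall>\<mu> \<nu>. maximal_monomial \<O> \<mu> \<longrightarrow> maximal_monomial \<O> \<nu> \<longrightarrow> size \<mu> = size \<nu>)"

definition num_monomials :: "'v multiset set \<Rightarrow> nat \<Rightarrow> nat" where
  "num_monomials \<O> i = card {\<mu> \<in> \<O>. size \<mu> = i}"

text \<open>Variables are drawn from the natural numbers; each order ideal uses only finitely many.\<close>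

definition pure_O_sequence :: "int list \<Rightarrow> bool" where
  "pure_O_sequence h \<longleftrightarrow>
     (\<exists>d. \<exists>\<O> :: nat multiset set. order_ideal d \<O> \<and> pure_ideal \<O> \<and>
        h = map (\<lambda>i. int (num_monomials \<O> i)) [0..<Suc d])"

end

theory Submission imports Defs begin

text \<open>
  The idea is to place the monomials of an order ideal in two variables in bijection with the
  bases of \<open>M\<close> so that degrees match a shelling of the independence complex of \<open>M\<^sup>*\<close>.

  List the non-loops of \<open>M\<close> as \<open>x\<^sub>0, \<dots>, x\<^sub>m\<^sub>-\<^sub>1\<close> so that each parallel class is a block of consecutive
  elements. A set \<open>A\<close> is independent in \<open>M\<^sup>*\<close> exactly when its complement meets two different
  classes, and because classes are blocks this happens exactly when the first and the last non-loop
  outside \<open>A\<close> are in different classes, i.e. form a basis of \<open>M\<close>. Let \<open>p\<close> non-loops precede the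
  first one and \<open>q\<close> follow the last one. All of these lie in \<open>A\<close>, the two basis elements do not,
  and every other element of the ground set, loops included, is free. So the independent sets of \<open>M\<^sup>*\<close>
  are partitioned into Boolean intervals, one for each basis of \<open>M\<close>, with the complements of the bases
  at the top and with bottoms of size \<open>p + q\<close>. A Boolean interval
  from size \<open>r\<close> to the rank contributes precisely \<open>\<lambda>\<^sup>r\<close> to the \<open>h\<close>-polynomial
  (\<open>coeff_h_poly_interval_partition\<close>), whence \<open>h\<^sub>k\<close> is the number of bases with \<open>p + q = k\<close>
  (\<open>h_poly_dual_rank_two\<close>).

  Encode a basis as the monomial \<open>x\<^sup>p y\<^sup>q\<close>. Decreasing \<open>p\<close> or \<open>q\<close> moves the two elements apart,
  so they stay in different classes: the monomials form an order ideal. Conversely,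
  as long as something lies between the two elements, one of the two can be moved inwards without
  entering the class of the other, so every maximal monomial has degree \<open>m - 2\<close>: the ideal is pure.
\<close>

section \<open>Partitions into Boolean intervals\<close>

text \<open>This is the binomial theorem on the subsets of \<open>U - R\<close>, shifted by \<open>R\<close>.\<close>
lemma sum_Boolean_interval:
  fixes a b :: "'b::comm_semiring_1"
  assumes "finite U" "R \<subseteq> U"
  shows "(\<Sum>A | R \<subseteq> A \<and> A \<subseteq> U. a ^ card A * b ^ (card U - card A)) =
    a ^ card R * (a + b) ^ (card U - card R)"
proof -
  let ?D = "U - R"
  have fin: "finite ?D" "finite R" using assms finite_subset by auto
  have cU: "card U = card R + card ?D"
    using assms by (simp add: card_Diff_subset fin card_mono)
  have "(\<Sum>A | R \<subseteq> A \<and> A \<subseteq> U. a ^ card A * b ^ (card U - card A)) =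
      (\<Sum>X\<in>Pow ?D. a ^ card R * (a ^ card X * b ^ card (?D - X)))"
  proof (rule sum.reindex_bij_witness[where i = "\<lambda>X. R \<union> X" and j = "\<lambda>A. A - R"])
    fix A assume A: "A \<in> {A. R \<subseteq> A \<and> A \<subseteq> U}"
    have fA: "finite A" using A assms(1) finite_subset by auto
    have "card A = card R + card (A - R)"
      using A fA fin by (simp add: card_Diff_subset card_mono)
    moreover have "card (?D - (A - R)) = card ?D - card (A - R)"
      using A fA by (intro card_Diff_subset) auto
    ultimately show "a ^ card R * (a ^ card (A - R) * b ^ card (?D - (A - R))) =
        a ^ card A * b ^ (card U - card A)"
      by (simp add: cU power_add mult.assoc)
  qed (use assms in auto)
  also have "\<dots> = a ^ card R * (\<Sum>X\<in>Pow ?D. (\<Prod>i\<in>X. a) * (\<Prod>i\<in>?D - X. b))"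
    by (simp add: sum_distrib_left)
  also have "\<dots> = a ^ card R * (a + b) ^ card ?D"
    by (subst prod_add[OF fin(1), symmetric]) simp
  finally show ?thesis by (simp add: cU)
qed

text \<open>The \<open>h\<close>-polynomial is the sum of \<open>\<lambda>\<^bsup>card A\<^esup> (1 - \<lambda>)\<^bsup>d - card A\<^esup>\<close> over all independent sets \<open>A\<close>.
  Over an interval whose top has size \<open>d\<close>, the binomial theorem with \<open>\<lambda> + (1 - \<lambda>) = 1\<close> collapses
  this sum to the single power given by the bottom.\<close>
lemma (in matroid) coeff_h_poly_interval_partition:
  assumes "finite T"
    and cover: "\<I> = (\<Union>t\<in>T. {A. R t \<subseteq> A \<and> A \<subseteq> U t})"
    and disjoint: "\<And>s t A. s \<in> T \<Longrightarrow> t \<in> T \<Longrightarrow> R s \<subseteq> A \<Longrightarrow> A \<subseteq> U s \<Longrightarrow>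
      R t \<subseteq> A \<Longrightarrow> A \<subseteq> U t \<Longrightarrow> s = t"
    and sub: "\<And>t. t \<in> T \<Longrightarrow> R t \<subseteq> U t"
    and card_U: "\<And>t. t \<in> T \<Longrightarrow> card (U t) = matroid_rank \<I>"
  shows "coeff (h_poly \<I>) k = int (card {t \<in> T. card (R t) = k})"
proof -
  let ?d = "matroid_rank \<I>"
  let ?g = "\<lambda>i. [:0, 1::int:] ^ i * [:1, -1:] ^ (?d - i)"
  have finI: "finite \<I>"
    using indep_subset_ground by (intro finite_subset[of \<I> "Pow E"]) (auto simp: finite_ground)
  have U: "U t \<in> \<I>" if "t \<in> T" for t using that sub[OF that] cover by auto
  have le: "card A \<le> ?d" if "A \<in> \<I>" for A
    using basis_exists card_basis indep_card_le_basis[OF that] by metis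
  have "h_poly \<I> = (\<Sum>i\<le>?d. \<Sum>A | A \<in> \<I> \<and> card A = i. ?g (card A))"
    unfolding h_poly_def num_indep_def by (intro sum.cong) (auto simp: mult.assoc)
  also have "\<dots> = (\<Sum>A\<in>\<I>. ?g (card A))"
    using le finI by (intro sum.group) auto
  also have "\<dots> = (\<Sum>t\<in>T. \<Sum>A | R t \<subseteq> A \<and> A \<subseteq> U t. ?g (card A))"
    unfolding cover
  proof (rule sum.UNION_disjoint)
    show "\<forall>t\<in>T. finite {A. R t \<subseteq> A \<and> A \<subseteq> U t}"
    proof
      fix t assume "t \<in> T"
      then show "finite {A. R t \<subseteq> A \<and> A \<subseteq> U t}"
        by (intro finite_subset[OF _ finI]) (auto simp: cover)
    qed
    show "\<forall>s\<in>T. \<forall>t\<in>T. s \<noteq> t \<longrightarrow>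
        {A. R s \<subseteq> A \<and> A \<subseteq> U s} \<inter> {A. R t \<subseteq> A \<and> A \<subseteq> U t} = {}"
      using disjoint by blast
  qed (rule assms(1))
  also have "\<dots> = (\<Sum>t\<in>T. [:0, 1:] ^ card (R t))"
  proof (rule sum.cong)
    fix t assume t: "t \<in> T"
    have one: "[:0, 1:] + [:1, -1:] = (1 :: int poly)" by (simp add: one_pCons)
    show "(\<Sum>A | R t \<subseteq> A \<and> A \<subseteq> U t. ?g (card A)) = [:0, 1:] ^ card (R t)"
      using sum_Boolean_interval[OF finite_indep[OF U[OF t]] sub[OF t],
          of "[:0, 1:] :: int poly" "[:1, -1:]"]
      by (simp add: card_U[OF t] one del: add_pCons)
  qed simp
  finally have h: "h_poly \<I> = (\<Sum>t\<in>T. [:0, 1:] ^ card (R t))" .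
  have x_power: "[:0, 1:] ^ n = (monom 1 n :: int poly)" for n
    by (simp add: monom_altdef)
  have "coeff (h_poly \<I>) k = (\<Sum>t\<in>T. if card (R t) = k then 1 else 0)"
    unfolding h x_power by (simp add: coeff_sum)
  also have "\<dots> = int (card {t \<in> T. card (R t) = k})"
    using assms(1) by (simp add: sum.If_cases Int_def)
  finally show ?thesis .
qed

section \<open>Ordering a rank two matroid by parallel classes\<close>

text \<open>If \<open>x\<close> and \<open>z\<close> were independent, augmenting \<open>{y}\<close> from \<open>{x, z}\<close> would make \<open>y\<close> independent of
  one of them.\<close>
lemma (in matroid) parallel_trans:
  assumes "{y} \<in> \<I>" "x = y \<or> {x, y} \<notin> \<I>" "y = z \<or> {y, z} \<notin> \<I>"
  shows "x = z \<or> {x, z} \<notin> \<I>"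
proof (rule ccontr)
  assume neg: "\<not> ?thesis"
  then have "card {y} < card {x, z}" by simp
  then obtain w where "w \<in> {x, z} - {y}" "insert w {y} \<in> \<I>"
    using augment[of "{y}" "{x, z}"] assms(1) neg by auto
  then show False using assms(2,3) by (auto simp: insert_commute)
qed

text \<open>Numbering the parallel classes turns independence of a pair of non-loops into inequality of
  natural numbers, by which the non-loops can then be sorted.\<close>
lemma (in matroid) parallel_class_key:
  obtains key :: "'a \<Rightarrow> nat"
  where "\<And>x y. {x} \<in> \<I> \<Longrightarrow> {y} \<in> \<I> \<Longrightarrow> key x \<noteq> key y \<longleftrightarrow> x \<noteq> y \<and> {x, y} \<in> \<I>"
proof -
  define cls where "cls x = {y. {y} \<in> \<I> \<and> (x = y \<or> {x, y} \<notin> \<I>)}" for x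
  have "cls x \<subseteq> E" for x
    unfolding cls_def using indep_subset_ground by blast
  then have "range cls \<subseteq> Pow E" by blast
  then have "finite (range cls)" by (rule finite_subset) (simp add: finite_ground)
  then obtain h :: "'a set \<Rightarrow> nat" where h: "inj_on h (range cls)"
    using finite_imp_inj_to_nat_seg by blast
  have eq: "cls x = cls y \<longleftrightarrow> x = y \<or> {x, y} \<notin> \<I>" if "{x} \<in> \<I>" "{y} \<in> \<I>" for x y
  proof
    assume "cls x = cls y"
    moreover have "y \<in> cls y" using that by (simp add: cls_def)
    ultimately have "y \<in> cls x" by simp
    then show "x = y \<or> {x, y} \<notin> \<I>" by (simp add: cls_def)
  next
    assume xy: "x = y \<or> {x, y} \<notin> \<I>"
    then have yx: "y = x \<or> {y, x} \<notin> \<I>" by (auto simp: insert_commute)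
    have "z \<in> cls x \<longleftrightarrow> z \<in> cls y" for z
      using parallel_trans[OF that(2) xy, of z] parallel_trans[OF that(1) yx, of z]
      unfolding cls_def by auto
    then show "cls x = cls y" by auto
  qed
  show thesis
  proof (rule that[of "h \<circ> cls"])
    fix x y assume xy: "{x} \<in> \<I>" "{y} \<in> \<I>"
    have "h (cls x) = h (cls y) \<longleftrightarrow> cls x = cls y"
      using inj_on_eq_iff[OF h, of "cls x" "cls y"] by auto
    then show "(h \<circ> cls) x \<noteq> (h \<circ> cls) y \<longleftrightarrow> x \<noteq> y \<and> {x, y} \<in> \<I>"
      using eq[OF xy] by auto
  qed
qed

lemma (in matroid) rank_two_enumeration:
  assumes rank: "matroid_rank \<I> = 2"
  obtains xs :: "'a list" and key :: "'a \<Rightarrow> nat"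
  where "distinct xs" "set xs \<subseteq> E" "sorted (map key xs)"
    and "\<And>B. basis \<I> B \<longleftrightarrow> (\<exists>x\<in>set xs. \<exists>y\<in>set xs. B = {x, y} \<and> key x \<noteq> key y)"
proof -
  obtain key :: "'a \<Rightarrow> nat" where
    key: "\<And>x y. {x} \<in> \<I> \<Longrightarrow> {y} \<in> \<I> \<Longrightarrow> key x \<noteq> key y \<longleftrightarrow> x \<noteq> y \<and> {x, y} \<in> \<I>"
    using parallel_class_key by blast
  have sub: "{x. {x} \<in> \<I>} \<subseteq> E" using indep_subset_ground by auto
  then have "finite {x. {x} \<in> \<I>}" using finite_ground finite_subset by blast
  then obtain ys where ys: "set ys = {x. {x} \<in> \<I>}" "distinct ys"
    using finite_distinct_list by blast
  obtain B0 where B0: "basis \<I> B0" using basis_exists by blast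
  have iff: "basis \<I> B \<longleftrightarrow> B \<in> \<I> \<and> card B = 2" for B
  proof
    show "basis \<I> B \<Longrightarrow> B \<in> \<I> \<and> card B = 2"
      using card_basis rank by (simp add: basis_def)
    show "B \<in> \<I> \<and> card B = 2 \<Longrightarrow> basis \<I> B"
      using basis_if_card[OF _ B0] card_basis[OF B0] rank by simp
  qed
  show thesis
  proof (rule that[of "sort_key key ys" key])
    fix B
    show "basis \<I> B \<longleftrightarrow>
      (\<exists>x\<in>set (sort_key key ys). \<exists>y\<in>set (sort_key key ys). B = {x, y} \<and> key x \<noteq> key y)"
      unfolding iff
    proof
      assume B: "B \<in> \<I> \<and> card B = 2"
      then obtain x y where xy: "B = {x, y}" "x \<noteq> y" by (auto simp: card_2_iff)
      have "{x} \<in> \<I>" "{y} \<in> \<I>" using B xy indep_subset by blast+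
      with B xy show "\<exists>x\<in>set (sort_key key ys). \<exists>y\<in>set (sort_key key ys).
          B = {x, y} \<and> key x \<noteq> key y"
        using key ys(1) by auto
    next
      assume "\<exists>x\<in>set (sort_key key ys). \<exists>y\<in>set (sort_key key ys).
          B = {x, y} \<and> key x \<noteq> key y"
      then show "B \<in> \<I> \<and> card B = 2" using key ys(1) by auto
    qed
  qed (use ys sub in auto)
qed

section \<open>Order ideals in two variables\<close>

definition monomial2 :: "nat \<Rightarrow> nat \<Rightarrow> nat multiset" where
  "monomial2 p q = replicate_mset p 0 + replicate_mset q 1"

lemma size_monomial2 [simp]: "size (monomial2 p q) = p + q"
  by (simp add: monomial2_def)

lemma count_monomial2 [simp]:
  "count (monomial2 p q) 0 = p" "count (monomial2 p q) (Suc 0) = q"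
  by (simp_all add: monomial2_def)

lemma monomial2_inject [simp]: "monomial2 p q = monomial2 p' q' \<longleftrightarrow> p = p' \<and> q = q'"
  by (metis count_monomial2)

lemma monomial2_dvd:
  "p \<le> p' \<Longrightarrow> q \<le> q' \<Longrightarrow> monomial2 p q \<subseteq># monomial2 p' q'"
  unfolding monomial2_def
  by (intro subset_mset.add_mono) (simp_all add: replicate_mset_msubseteq_iff)

lemma divisor_of_monomial2:
  assumes "\<nu> \<subseteq># monomial2 p q"
  obtains p' q' where "\<nu> = monomial2 p' q'" "p' \<le> p" "q' \<le> q"
proof
  show *: "\<nu> = monomial2 (count \<nu> 0) (count \<nu> 1)"
  proof (rule multiset_eqI)
    fix v
    show "count \<nu> v = count (monomial2 (count \<nu> 0) (count \<nu> 1)) v"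
      using assms mset_subset_eq_count[OF assms, of v]
      by (auto simp: monomial2_def split: if_splits)
  qed
  show "count \<nu> 0 \<le> p" "count \<nu> 1 \<le> q"
    using mset_subset_eq_count[OF assms, of 0] mset_subset_eq_count[OF assms, of 1] by simp_all
qed

text \<open>The exponent pairs \<open>T\<close> describe an order ideal by \<open>down\<close>. It is pure by \<open>up\<close>: a monomial of degree
  less than \<open>e\<close> has a proper multiple in the ideal, so all maximal ones have degree \<open>e\<close>. The bound \<open>d\<close>
  may exceed \<open>e\<close>, which pads the sequence with zeros.\<close>
lemma pure_O_sequence_two_variables:
  assumes "(0, 0) \<in> T"
    and bounded: "\<And>p q. (p, q) \<in> T \<Longrightarrow> p + q \<le> e" "e \<le> d"
    and down: "\<And>p q p' q'. (p, q) \<in> T \<Longrightarrow> p' \<le> p \<Longrightarrow> q' \<le> q \<Longrightarrow> (p', q') \<in> T"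
    and up: "\<And>p q. (p, q) \<in> T \<Longrightarrow> p + q < e \<Longrightarrow> (Suc p, q) \<in> T \<or> (p, Suc q) \<in> T"
  shows "pure_O_sequence (map (\<lambda>k. int (card {(p, q) \<in> T. p + q = k})) [0..<Suc d])"
proof -
  let ?O = "(\<lambda>(p, q). monomial2 p q) ` T"
  have "order_ideal d ?O"
    unfolding order_ideal_def
  proof (intro conjI)
    show "?O \<noteq> {}" using assms(1) by blast
    have "\<forall>\<mu>\<in>?O. set_mset \<mu> \<subseteq> {0, 1}"
      by (auto simp: monomial2_def split: if_splits)
    then show "\<exists>V. finite V \<and> (\<forall>\<mu>\<in>?O. set_mset \<mu> \<subseteq> V)"
      by (intro exI[of _ "{0, 1}"]) simp
    show "\<forall>\<mu>\<in>?O. size \<mu> \<le> d" using bounded by fastforce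
    show "\<forall>\<mu>\<in>?O. \<forall>\<nu>. \<nu> \<subseteq># \<mu> \<longrightarrow> \<nu> \<in> ?O"
    proof (intro ballI allI impI)
      fix \<mu> \<nu> assume "\<mu> \<in> ?O" "\<nu> \<subseteq># \<mu>"
      then obtain p q where pq: "(p, q) \<in> T" "\<nu> \<subseteq># monomial2 p q" by auto
      from pq(2) obtain p' q' where "\<nu> = monomial2 p' q'" "p' \<le> p" "q' \<le> q"
        by (rule divisor_of_monomial2)
      with down[OF pq(1)] show "\<nu> \<in> ?O" by force
    qed
  qed
  moreover have "size \<mu> = e" if max: "maximal_monomial ?O \<mu>" for \<mu>
  proof -
    obtain p q where pq: "(p, q) \<in> T" "\<mu> = monomial2 p q"
      using max unfolding maximal_monomial_def by auto
    have no_multiple: "\<nu> = \<mu>" if "\<nu> \<in> ?O" "\<mu> \<subseteq># \<nu>" for \<nu>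
      using max that unfolding maximal_monomial_def by blast
    have "\<not> p + q < e"
    proof
      assume "p + q < e"
      then consider "(Suc p, q) \<in> T" | "(p, Suc q) \<in> T" using up pq(1) by blast
      then show False
      proof cases
        case 1
        then have "monomial2 (Suc p) q \<in> ?O" by force
        then have "monomial2 (Suc p) q = \<mu>" by (rule no_multiple) (simp add: pq(2) monomial2_dvd)
        then show False using pq(2) by simp
      next
        case 2
        then have "monomial2 p (Suc q) \<in> ?O" by force
        then have "monomial2 p (Suc q) = \<mu>" by (rule no_multiple) (simp add: pq(2) monomial2_dvd)
        then show False using pq(2) by simp
      qed
    qed
    with bounded(1)[OF pq(1)] pq(2) show ?thesis by simp
  qed
  then have "pure_ideal ?O" unfolding pure_ideal_def by metis
  moreover have "num_monomials ?O k = card {(p, q) \<in> T. p + q = k}" for k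
  proof -
    have "{\<mu> \<in> ?O. size \<mu> = k} = (\<lambda>(p, q). monomial2 p q) ` {(p, q) \<in> T. p + q = k}"
      by auto
    moreover have "inj_on (\<lambda>(p, q). monomial2 p q) {(p, q) \<in> T. p + q = k}"
      by (auto simp: inj_on_def)
    ultimately show ?thesis unfolding num_monomials_def by (simp add: card_image)
  qed
  ultimately show ?thesis unfolding pure_O_sequence_def by (intro exI[of _ d] exI[of _ ?O]) simp
qed

section \<open>The dual of a rank two matroid\<close>

text \<open>The function \<open>c\<close> gives the parallel class of the \<open>i\<close>-th non-loop in sorted order. The pair
  \<open>(p, q)\<close> stands for the basis formed by the non-loop that has \<open>p\<close> others before it and the one that has
  \<open>q\<close> others after it. The rank of the dual is \<open>m - 2\<close> plus the number of loops of \<open>M\<close>, hence only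
  an inequality.\<close>
lemma (in matroid) h_poly_dual_rank_two:
  assumes "matroid_rank \<I> = 2"
  obtains m and c :: "nat \<Rightarrow> nat"
  where "\<And>i j. i \<le> j \<Longrightarrow> j < m \<Longrightarrow> c i \<le> c j"
    and "2 \<le> m" "c 0 \<noteq> c (m - 1)" "m - 2 \<le> matroid_rank (dual_indep E \<I>)"
    and "\<And>k. coeff (h_poly (dual_indep E \<I>)) k =
      int (card {(p, q) \<in> {(p, q). p + q + 2 \<le> m \<and> c p \<noteq> c (m - 1 - q)}. p + q = k})"
proof -
  interpret D: matroid E "dual_indep E \<I>" by (rule matroid_dual)
  obtain xs :: "'a list" and key :: "'a \<Rightarrow> nat" where
    xs: "distinct xs" "set xs \<subseteq> E" "sorted (map key xs)" and
    basis: "\<And>B. basis \<I> B \<longleftrightarrow> (\<exists>x\<in>set xs. \<exists>y\<in>set xs. B = {x, y} \<and> key x \<noteq> key y)"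
    using rank_two_enumeration[OF assms] by metis
  define m where "m = length xs"
  define c where "c i = key (xs ! i)" for i
  have mono: "c i \<le> c j" if "i \<le> j" "j < m" for i j
    using sorted_nth_mono[OF xs(3), of i j] that by (simp add: c_def m_def)
  have basis_index: "basis \<I> B \<longleftrightarrow> (\<exists>i j. i < j \<and> j < m \<and> c i \<noteq> c j \<and> B = {xs ! i, xs ! j})" for B
  proof
    assume "basis \<I> B"
    then obtain x y where xy: "x \<in> set xs" "y \<in> set xs" "B = {x, y}" "key x \<noteq> key y"
      unfolding basis by blast
    then obtain i j where "i < m" "xs ! i = x" "j < m" "xs ! j = y"
      unfolding m_def in_set_conv_nth by blast
    with xy have ij: "i < m" "j < m" "B = {xs ! i, xs ! j}" "c i \<noteq> c j"
      by (simp_all add: c_def)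
    then consider "i < j" | "j < i" by (metis linorder_neqE_nat)
    then show "\<exists>i j. i < j \<and> j < m \<and> c i \<noteq> c j \<and> B = {xs ! i, xs ! j}"
      using ij by cases (metis, metis insert_commute)
  next
    assume "\<exists>i j. i < j \<and> j < m \<and> c i \<noteq> c j \<and> B = {xs ! i, xs ! j}"
    then show "basis \<I> B" unfolding basis m_def c_def
      by (metis nth_mem order.strict_trans)
  qed
  define T where "T = {(p, q). p + q + 2 \<le> m \<and> c p \<noteq> c (m - 1 - q)}"
  \<comment> \<open>The interval of all \<open>A\<close> for which \<open>(p, q)\<close> is the first and last non-loop outside \<open>A\<close>.\<close>
  define R where "R = (\<lambda>(p, q). (\<lambda>i. xs ! i) ` ({..<p} \<union> {m - q..<m}))"
  define U where "U = (\<lambda>(p, q). E - {xs ! p, xs ! (m - 1 - q)})"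
  have "T \<subseteq> {..m} \<times> {..m}" by (auto simp: T_def)
  then have fin_T: "finite T" by (rule finite_subset) simp
  have inj: "xs ! i = xs ! j \<longleftrightarrow> i = j" if "i < m" "j < m" for i j
    using xs(1) that by (simp add: m_def nth_eq_iff_index_eq)
  have ground: "xs ! i \<in> E" if "i < m" for i using xs(2) that by (auto simp: m_def)
  have basis_T: "basis \<I> {xs ! p, xs ! (m - 1 - q)}" if "(p, q) \<in> T" for p q
    unfolding basis_index using that
    by (intro exI[of _ p] exI[of _ "m - 1 - q"]) (auto simp: T_def)
  have R_sub_U: "R t \<subseteq> U t" if "t \<in> T" for t
    using that ground by (auto simp: T_def R_def U_def inj)
  have card_U: "card (U t) = matroid_rank (dual_indep E \<I>)" if "t \<in> T" for t
  proof (rule D.card_basis)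
    show "basis (dual_indep E \<I>) (U t)"
      using that basis_T unfolding basis_dual_iff U_def by (cases t) blast
  qed
  have card_R: "card (R (p, q)) = p + q" if "(p, q) \<in> T" for p q
  proof -
    have "inj_on (\<lambda>i. xs ! i) ({..<p} \<union> {m - q..<m})"
      using that by (auto simp: inj_on_def inj T_def)
    then have "card (R (p, q)) = card ({..<p} \<union> {m - q..<m})"
      by (simp add: R_def card_image)
    also have "\<dots> = p + q" using that by (subst card_Un_disjoint) (auto simp: T_def)
    finally show ?thesis .
  qed
  have cover: "dual_indep E \<I> = (\<Union>t\<in>T. {A. R t \<subseteq> A \<and> A \<subseteq> U t})"
  proof (intro equalityI subsetI)
    fix A assume "A \<in> dual_indep E \<I>"
    then obtain i j where ij: "i < j" "j < m" "c i \<noteq> c j" "A \<subseteq> E - {xs ! i, xs ! j}"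
      unfolding dual_indep_def basis_index by blast
    \<comment> \<open>Passing from \<open>i\<close>, \<open>j\<close> to the outermost non-loops outside \<open>A\<close> keeps the classes distinct,
      because \<open>c\<close> is monotone.\<close>
    define p where "p = (LEAST p. xs ! p \<notin> A)"
    define q where "q = (LEAST q. xs ! (m - 1 - q) \<notin> A)"
    have p: "xs ! p \<notin> A" "p \<le> i"
      using ij LeastI[of "\<lambda>p. xs ! p \<notin> A" i] Least_le[of "\<lambda>p. xs ! p \<notin> A" i]
      by (auto simp: p_def)
    have q: "xs ! (m - 1 - q) \<notin> A" "q \<le> m - 1 - j"
      using ij LeastI[of "\<lambda>q. xs ! (m - 1 - q) \<notin> A" "m - 1 - j"]
        Least_le[of "\<lambda>q. xs ! (m - 1 - q) \<notin> A" "m - 1 - j"]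
      by (auto simp: q_def)
    have "c p \<le> c i" "c i \<le> c j" "c j \<le> c (m - 1 - q)"
      using p q ij by (auto intro!: mono)
    then have T: "(p, q) \<in> T" using ij p q by (auto simp: T_def)
    have "xs ! k \<in> A" if "k < p" for k
      using not_less_Least[of k "\<lambda>p. xs ! p \<notin> A"] that by (auto simp: p_def)
    moreover have "xs ! k \<in> A" if "m - q \<le> k" "k < m" for k
    proof -
      have "m - 1 - k < q" "m - 1 - (m - 1 - k) = k" using that by auto
      then show ?thesis
        using not_less_Least[of "m - 1 - k" "\<lambda>q. xs ! (m - 1 - q) \<notin> A"]
        by (simp add: q_def)
    qed
    ultimately have "R (p, q) \<subseteq> A" by (auto simp: R_def)
    moreover have "A \<subseteq> U (p, q)" using p q ij by (auto simp: U_def)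
    ultimately show "A \<in> (\<Union>t\<in>T. {A. R t \<subseteq> A \<and> A \<subseteq> U t})" using T by blast
  next
    fix A assume "A \<in> (\<Union>t\<in>T. {A. R t \<subseteq> A \<and> A \<subseteq> U t})"
    then obtain p q where "(p, q) \<in> T" "A \<subseteq> U (p, q)" by auto
    then show "A \<in> dual_indep E \<I>"
      using basis_T unfolding dual_indep_def U_def by auto
  qed
  have disjoint: "s = t" if "s \<in> T" "t \<in> T" "R s \<subseteq> A" "A \<subseteq> U s" "R t \<subseteq> A" "A \<subseteq> U t" for s t A
  proof -
    obtain p q p' q' where st: "s = (p, q)" "t = (p', q')" by (cases s, cases t) auto
    have notin: "xs ! p \<notin> A" "xs ! p' \<notin> A" "xs ! (m - 1 - q) \<notin> A" "xs ! (m - 1 - q') \<notin> A"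
      using that(4,6) by (auto simp: st U_def)
    have "\<not> p < p'" "\<not> p' < p" using notin that(3,5) by (auto simp: st R_def)
    moreover have "\<not> q < q'"
    proof
      assume "q < q'"
      then have "xs ! (m - 1 - q) \<in> R t" using that(2) by (auto simp: st R_def T_def)
      then show False using notin that(5) by blast
    qed
    moreover have "\<not> q' < q"
    proof
      assume "q' < q"
      then have "xs ! (m - 1 - q') \<in> R s" using that(1) by (auto simp: st R_def T_def)
      then show False using notin that(3) by blast
    qed
    ultimately show ?thesis by (simp add: st)
  qed
  have h: "coeff (h_poly (dual_indep E \<I>)) k = int (card {(p, q) \<in> T. p + q = k})" for k
  proof -
    have "coeff (h_poly (dual_indep E \<I>)) k = int (card {t \<in> T. card (R t) = k})"
      by (rule D.coeff_h_poly_interval_partition[OF fin_T cover disjoint R_sub_U card_U])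
    also have "{t \<in> T. card (R t) = k} = {(p, q) \<in> T. p + q = k}" using card_R by auto
    finally show ?thesis .
  qed
  obtain p q where pq: "(p, q) \<in> T"
    using D.empty_indep unfolding cover by auto
  have "2 \<le> m" using pq by (auto simp: T_def)
  moreover have "c 0 \<noteq> c (m - 1)"
  proof -
    have "c 0 \<le> c p" "c p \<le> c (m - 1 - q)" "c (m - 1 - q) \<le> c (m - 1)"
      using pq by (auto simp: T_def intro!: mono)
    then show ?thesis using pq by (auto simp: T_def)
  qed
  moreover have "m - 2 \<le> matroid_rank (dual_indep E \<I>)"
  proof -
    have "m - 2 \<le> card E - card {xs ! p, xs ! (m - 1 - q)}"
    proof (rule diff_le_mono2[THEN order.trans[rotated]])
      show "card {xs ! p, xs ! (m - 1 - q)} \<le> 2" by (simp add: card_insert_if)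
      show "m - 2 \<le> card E - 2"
        using card_mono[OF finite_ground xs(2)] distinct_card[OF xs(1)] by (simp add: m_def)
    qed
    also have "\<dots> \<le> card (U (p, q))" by (simp add: U_def diff_card_le_card_Diff)
    finally show ?thesis using card_U[OF pq] by simp
  qed
  ultimately show thesis using that[of m c] mono h unfolding T_def by blast
qed

theorem theorem3p1:
  fixes E :: "'a set" and \<I> :: "'a set set"
  assumes "matroid E \<I>"
    and "matroid_rank \<I> = 2"
  shows "pure_O_sequence (h_vector (dual_indep E \<I>))"
proof (rule matroid.h_poly_dual_rank_two[OF assms])
  fix m and c :: "nat \<Rightarrow> nat"
  assume
    mono: "\<And>i j. i \<le> j \<Longrightarrow> j < m \<Longrightarrow> c i \<le> c j" and
    m: "2 \<le> m" "c 0 \<noteq> c (m - 1)" "m - 2 \<le> matroid_rank (dual_indep E \<I>)" and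
    h: "\<And>k. coeff (h_poly (dual_indep E \<I>)) k =
      int (card {(p, q) \<in> {(p, q). p + q + 2 \<le> m \<and> c p \<noteq> c (m - 1 - q)}. p + q = k})"
  let ?T = "{(p, q). p + q + 2 \<le> m \<and> c p \<noteq> c (m - 1 - q)}"
  have down: "(p', q') \<in> ?T" if "(p, q) \<in> ?T" "p' \<le> p" "q' \<le> q" for p q p' q'
  proof -
    have "c p' \<le> c p" "c p \<le> c (m - 1 - q)" "c (m - 1 - q) \<le> c (m - 1 - q')"
      using that by (auto intro!: mono)
    then show ?thesis using that by auto
  qed
  have up: "(Suc p, q) \<in> ?T \<or> (p, Suc q) \<in> ?T" if "(p, q) \<in> ?T" "p + q < m - 2" for p q
  proof (rule ccontr)
    \<comment> \<open>If neither element can move inwards, the neighbour of each shares the class of the other;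
      monotonicity of \<open>c\<close> then forces all of them into one class.\<close>
    assume neg: "\<not> ?thesis"
    have "c p \<le> c (Suc p)" "c (Suc p) \<le> c (m - 1 - q)"
      "c (Suc p) \<le> c (m - 1 - Suc q)" "c (m - 1 - Suc q) \<le> c (m - 1 - q)"
      using that by (auto intro!: mono)
    then show False using neg that by auto
  qed
  show ?thesis
    unfolding h_vector_def h
    by (rule pure_O_sequence_two_variables[where e = "m - 2"]) (use m down up in auto)
qed

end
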